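(* Let $\rho\in(1/2,1)$. The stationary measure $\pi_\rho$ of the facilitated exclusion process and the probability measure $\widehat\mu_\rho$ on $\widehat{\mathcal{E}}_{\mathbb{Z}}$ correspond to each other through the mapping $\Pi$: $\widehat\mu_\rho$ is the image of $\pi_\rho$ under $\Pi$, and $\pi_\rho$ is the image of $\widehat\mu_\rho$ under $\Pi^{-1}$ (written $\pi_\rho=\widehat\mu_\rho\circ\Pi$ and $\widehat\mu_\rho=\pi_\rho\circ\Pi^{-1}$).
   Context: $\mathbb{N}=\{0,1,2,\dots\}$. **Measure $\pi_\rho$.** A configuration $\sigma$ on a connected set $B\subset\mathbb{Z}$ is ergodic if $\sigma_x+\sigma_{x+1}\ge1$ whenever $x,x+1\in B$; $\mathcal{E}_{\mathbb{Z}}$ is the set of ergodic configurations on $\mathbb{Z}$. $\pi_\rho$ is the translation-invariant probability measure on $\{0,1\}^{\mathbb{Z}}$ (charging only $\mathcal{E}_{\mathbb{Z}}$) such that for $\ell\ge1$ and $\sigma\in\{0,1\}^{\{1,\dots,\ell\}}$ with $p=\sum_x\sigma_x$, $$\pi_\rho(\eta_{|\{1,\dots,\ell\}}=\sigma)=\mathbf 1_{\{\sigma\text{ ergodic}\}}(1-\rho)\Big(\frac{1-\rho}{\rho}\Big)^{\ell-1-p}\Big(\frac{2\rho-1}{\rho}\Big)^{2p-\ell+1-\sigma_1-\sigma_\ell}.$$ **Mapping $\Pi$.** For an ergodic configuration $\eta$ (with infinitely many empty sites on both sides of the origin, which holds $\pi_\rho$-a.s.), let $X_0\le0$ be the position of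 the first empty site to the left of or at the origin ($\eta_{X_0}=0$ and $\eta_x=1$ for $X_0<x\le0$). For $y>0$ (resp. $y<0$), $X_y$ is the position of the $|y|$-th empty site to the right (resp. left) of $X_0$. Set $\omega_y=X_{y+1}-X_y-2\in\mathbb{N}$ and $\Pi(\eta)=(\omega,X_0)$. $\Pi$ is a bijection onto $$\widehat{\mathcal{E}}_{\mathbb{Z}}=\{(\omega,X_0)\in\mathbb{N}^{\mathbb{Z}}\times\mathbb{Z}:\ -\omega_0-1\le X_0\le0\}.$$ **Measure $\widehat\mu_\rho$.** Let $a(\rho)=\frac{2\rho-1}{\rho}$. Under $\widehat\mu_\rho$: the variables $(\omega_y)_{y\ne0}$ are i.i.d. with $\mathbb{P}(\omega_y=k)=a(\rho)^k(1-a(\rho))$, $k\ge0$; $\omega_0$ is independent of them with $\widehat\mu_\rho(\omega_0=k)=(k+2)a(\rho)^k\rho(1-a(\rho))^2$, $k\ge0$; conditionally on $\omega$, $X_0$ is uniform on $\{-\omega_0-1,\dots,0\}$. *)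

theory Defs
  imports "HOL-Probability.Probability"
begin

text \<open>A site \<open>x\<close> of a configuration \<open>\<eta>\<close> is occupied (\<open>\<eta>\<^sub>x = 1\<close>) iff \<open>\<eta> x\<close> holds.
  Configurations on a subset of the integers are total functions, only whose values on that
  subset matter.\<close>

type_synonym config = "int \<Rightarrow> bool"

definition ergodic :: "int set \<Rightarrow> config \<Rightarrow> bool" where
  "ergodic B \<sigma> \<longleftrightarrow>
     (\<forall>x. x \<in> B \<and> x + 1 \<in> B \<longrightarrow> (of_bool (\<sigma> x) + of_bool (\<sigma> (x + 1)) :: nat) \<ge> 1)"

definition config_space :: "config measure" where
  "config_space = Pi\<^sub>M UNIV (\<lambda>_. count_space UNIV)"

definition translation_invariant :: "config measure \<Rightarrow> bool" where
  "translation_invariant P \<longleftrightarrow> (\<forall>z. distr P config_space (\<lambda>\<eta> x. \<eta> (x + z)) = P)"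

text \<open>The exponent \<open>l - 1 - p\<close> is \<open>-1\<close> for the fully occupied box, hence integer powers.\<close>

definition pi_marginal :: "real \<Rightarrow> int \<Rightarrow> config \<Rightarrow> real" where
  "pi_marginal \<rho> l \<sigma> =
     (let p = (\<Sum>x\<in>{1..l}. of_bool (\<sigma> x) :: int) in
      if ergodic {1..l} \<sigma>
      then (1 - \<rho>) * ((1 - \<rho>) / \<rho>) powi (l - 1 - p)
             * ((2 * \<rho> - 1) / \<rho>) powi (2 * p - l + 1 - of_bool (\<sigma> 1) - of_bool (\<sigma> l))
      else 0)"

text \<open>\<open>P\<close> is the measure \<open>\<pi>\<^sub>\<rho>\<close>; these properties determine it uniquely.\<close>

definition is_pi :: "real \<Rightarrow> config measure \<Rightarrow> bool" where
  "is_pi \<rho> P \<longleftrightarrow>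
     prob_space P \<and> sets P = sets config_space \<and> translation_invariant P \<and>
     (AE \<eta> in P. ergodic UNIV \<eta>) \<and>
     (\<forall>l\<ge>1. \<forall>\<sigma>. measure P {\<eta> \<in> space P. \<forall>x\<in>{1..l}. \<eta> x = \<sigma> x} = pi_marginal \<rho> l \<sigma>)"

text \<open>The domain of \<open>\<Pi>\<close>.\<close>

definition ergodic_inf :: "config set" where
  "ergodic_inf = {\<eta>. ergodic UNIV \<eta> \<and> infinite {x. x < 0 \<and> \<not> \<eta> x} \<and> infinite {x. x > 0 \<and> \<not> \<eta> x}}"

definition origin_hole :: "config \<Rightarrow> int" where
  "origin_hole \<eta> = (THE x. x \<le> 0 \<and> \<not> \<eta> x \<and> (\<forall>z. x < z \<and> z \<le> 0 \<longrightarrow> \<eta> z))"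

definition hole :: "config \<Rightarrow> int \<Rightarrow> int" where
  "hole \<eta> y =
     (let X0 = origin_hole \<eta> in
      if y = 0 then X0
      else if y > 0 then (THE x. X0 < x \<and> \<not> \<eta> x \<and> int (card {z. X0 < z \<and> z \<le> x \<and> \<not> \<eta> z}) = \<bar>y\<bar>)
      else (THE x. x < X0 \<and> \<not> \<eta> x \<and> int (card {z. x \<le> z \<and> z < X0 \<and> \<not> \<eta> z}) = \<bar>y\<bar>))"

text \<open>On \<open>ergodic_inf\<close> consecutive empty sites are at distance at least 2, so \<open>nat\<close> does not
  truncate.\<close>

definition Pi_map :: "config \<Rightarrow> (int \<Rightarrow> nat) \<times> int" where
  "Pi_map \<eta> = ((\<lambda>y. nat (hole \<eta> (y + 1) - hole \<eta> y - 2)), hole \<eta> 0)"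

definition hat_E :: "((int \<Rightarrow> nat) \<times> int) set" where
  "hat_E = {(\<omega>, X0). - int (\<omega> 0) - 1 \<le> X0 \<and> X0 \<le> 0}"

definition hat_space :: "((int \<Rightarrow> nat) \<times> int) measure" where
  "hat_space = restrict_space (Pi\<^sub>M UNIV (\<lambda>_. count_space UNIV) \<Otimes>\<^sub>M count_space UNIV) hat_E"

definition a_param :: "real \<Rightarrow> real" where
  "a_param \<rho> = (2 * \<rho> - 1) / \<rho>"

text \<open>The law of the family \<open>\<omega>\<close>: \<open>geometric_pmf (1 - a)\<close> has mass \<open>a ^ k * (1 - a)\<close> at \<open>k\<close>.\<close>

definition omega_law :: "real \<Rightarrow> (int \<Rightarrow> nat) measure" where
  "omega_law \<rho> = Pi\<^sub>M UNIV (\<lambda>y.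
     if y = 0
     then density (count_space UNIV)
            (\<lambda>k. ennreal ((real k + 2) * a_param \<rho> ^ k * \<rho> * (1 - a_param \<rho>)\<^sup>2))
     else measure_pmf (geometric_pmf (1 - a_param \<rho>)))"

definition mu_hat :: "real \<Rightarrow> ((int \<Rightarrow> nat) \<times> int) measure" where
  "mu_hat \<rho> = omega_law \<rho> \<bind>
     (\<lambda>\<omega>. distr (uniform_count_measure {- int (\<omega> 0) - 1..0}) hat_space (\<lambda>X0. (\<omega>, X0)))"

end

theory Submission
  imports Defs
begin

text \<open>The \<open>\<sigma>\<close>-algebra on the image side is generated by the countable, intersection-stable family
  of cylinders that prescribe \<open>X\<^sub>0\<close> and \<open>\<omega>\<^sub>y = k\<^sub>y\<close> for \<open>\<bar>y\<bar> \<le> n\<close>. The preimage of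
  such a cylinder under \<open>\<Pi>\<close> prescribes \<open>\<eta>\<close> exactly on the interval from \<open>X\<^bsub>-n\<^esub>\<close> to
  \<open>X\<^bsub>n+1\<^esub>\<close>, which starts and ends with a hole and contains \<open>2n + 2\<close> of them. By translation
  invariance its probability is read off the marginal formula: with \<open>K = \<Sum> k\<^sub>y\<close> it is
  \<open>(1 - \<rho>) (1 - a)\<^bsup>2n+1\<^esup> a\<^bsup>K\<^esup>\<close>. The product law gives the same value, because the size
  bias \<open>k\<^sub>0 + 2\<close> of \<open>\<omega>\<^sub>0\<close> cancels against the uniform choice of \<open>X\<^sub>0\<close> among
  \<open>k\<^sub>0 + 2\<close> sites and \<open>\<rho> (1 - a) = 1 - \<rho>\<close>. The second identity follows since the inverse of
  \<open>\<Pi>\<close> is measurable and \<open>\<Pi>\<close> is defined almost surely, a fully occupied box of length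
  \<open>n + 1\<close> having probability \<open>\<rho> a\<^bsup>n\<^esup>\<close>.\<close>

section \<open>The bijection\<close>

lemma strict_mono_int_step:
  fixes g :: "int \<Rightarrow> int"
  assumes "\<And>y. g y < g (y + 1)"
  shows "strict_mono g"
proof (rule strict_monoI)
  fix x y :: int
  assume "x < y"
  then show "g x < g y"
    by (induction rule: int_gr_induct) (use assms less_trans in \<open>blast+\<close>)
qed

text \<open>The condition \<open>g 0 \<le> 0 \<and> 0 < g 1\<close> pins down the labelling, which
  would otherwise be free up to a shift: label 0 goes to the last element of \<open>S\<close> at or
  left of the origin.\<close>

definition enumerates :: "(int \<Rightarrow> int) \<Rightarrow> int set \<Rightarrow> bool" where
  "enumerates g S \<longleftrightarrow> strict_mono g \<and> range g = S \<and> g 0 \<le> 0 \<and> 0 < g 1"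

text \<open>An index beyond \<open>y + 1\<close> would place \<open>g (y + 1)\<close> strictly
  between \<open>g y\<close> and \<open>u\<close>, where \<open>S\<close> has no element. The next
  label can thus be identified from local data.\<close>

lemma enumerates_succ:
  fixes g :: "int \<Rightarrow> int"
  assumes "strict_mono g" "range g = S" "u \<in> S" "g y < u" "\<And>z. g y < z \<Longrightarrow> z < u \<Longrightarrow> z \<notin> S"
  shows "u = g (y + 1)"
proof -
  obtain j where j: "u = g j" using assms by auto
  have "y < j" using assms(4) j by (simp add: strict_mono_less[OF assms(1)])
  moreover have "\<not> y + 1 < j"
  proof
    assume "y + 1 < j"
    then have "g (y + 1) < u" "g y < g (y + 1)" using j by (auto simp: strict_mono_less[OF assms(1)])
    then show False using assms(2,5) by blast
  qed
  ultimately have "j = y + 1" by simp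
  then show ?thesis using j by simp
qed

lemma enumerates_pred:
  fixes g :: "int \<Rightarrow> int"
  assumes "strict_mono g" "range g = S" "u \<in> S" "u < g y" "\<And>z. u < z \<Longrightarrow> z < g y \<Longrightarrow> z \<notin> S"
  shows "u = g (y - 1)"
proof -
  obtain j where j: "u = g j" using assms by auto
  have "j < y" using assms(4) j by (simp add: strict_mono_less[OF assms(1)])
  moreover have "\<not> j < y - 1"
  proof
    assume "j < y - 1"
    then have "u < g (y - 1)" "g (y - 1) < g y" using j by (auto simp: strict_mono_less[OF assms(1)])
    then show False using assms(2,5) by blast
  qed
  ultimately have "j = y - 1" by simp
  then show ?thesis using j by simp
qed

text \<open>An increasing enumeration turns counting holes between \<open>g 0\<close> and
  \<open>g j\<close> into counting labels, so \<open>g y\<close> is the unique solution of the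
  description defining \<open>hole\<close>. Later facts on \<open>hole\<close> avoid the definite
  descriptions through this lemma.\<close>

lemma hole_eqI:
  assumes "enumerates g {x. \<not> \<eta> x}"
  shows "hole \<eta> = g"
proof
  fix y :: int
  have sm: "strict_mono g" and rg: "range g = {x. \<not> \<eta> x}" and g0: "g 0 \<le> 0" "0 < g 1"
    using assms by (auto simp: enumerates_def)
  note lt = strict_mono_less[OF sm] and le = strict_mono_less_eq[OF sm]
  have hl: "\<not> \<eta> (g j)" for j using rg by auto
  have ex: "\<exists>j. x = g j" if "\<not> \<eta> x" for x using rg that by auto
  \<comment> \<open>No label lies strictly between 0 and 1.\<close>
  have no: "\<eta> z" if "g 0 < z" "z \<le> 0" for z
  proof (rule ccontr)
    assume "\<not> \<eta> z"
    then obtain j where "z = g j" using ex by blast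
    with that g0(2) have "g 0 < g j" "g j < g 1" by auto
    then show False by (simp add: lt)
  qed
  have o: "origin_hole \<eta> = g 0"
    unfolding origin_hole_def
  proof (rule the_equality)
    show "g 0 \<le> 0 \<and> \<not> \<eta> (g 0) \<and> (\<forall>z. g 0 < z \<and> z \<le> 0 \<longrightarrow> \<eta> z)"
      using g0 hl no by auto
    fix x assume x: "x \<le> 0 \<and> \<not> \<eta> x \<and> (\<forall>z. x < z \<and> z \<le> 0 \<longrightarrow> \<eta> z)"
    then have "\<not> g 0 < x" "\<not> x < g 0" using no hl g0 by blast+
    then show "x = g 0" by simp
  qed
  have up: "{z. g 0 < z \<and> z \<le> g j \<and> \<not> \<eta> z} = g ` {0<..j}" for j
    using hl ex by (auto simp: lt le dest!: ex)
  have dn: "{z. g j \<le> z \<and> z < g 0 \<and> \<not> \<eta> z} = g ` {j..<0}" for j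
    using hl ex by (auto simp: lt le dest!: ex)
  have ci: "card (g ` A) = card A" for A
    using strict_mono_imp_inj_on[OF sm] by (intro card_image) (rule inj_on_subset, auto)
  consider "y = 0" | "y > 0" | "y < 0" by linarith
  then show "hole \<eta> y = g y"
  proof cases
    case 1 then show ?thesis by (simp add: hole_def o)
  next
    case 2
    have "(THE x. g 0 < x \<and> \<not> \<eta> x \<and> int (card {z. g 0 < z \<and> z \<le> x \<and> \<not> \<eta> z}) = \<bar>y\<bar>) = g y"
    proof (rule the_equality)
      show "g 0 < g y \<and> \<not> \<eta> (g y) \<and> int (card {z. g 0 < z \<and> z \<le> g y \<and> \<not> \<eta> z}) = \<bar>y\<bar>"
        using 2 hl by (simp add: up ci lt)
      fix x assume x: "g 0 < x \<and> \<not> \<eta> x \<and> int (card {z. g 0 < z \<and> z \<le> x \<and> \<not> \<eta> z}) = \<bar>y\<bar>"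
      then obtain j where "x = g j" using ex by blast
      with x 2 show "x = g y" by (auto simp: up ci lt split: if_splits)
    qed
    with 2 show ?thesis by (simp add: hole_def o)
  next
    case 3
    have "(THE x. x < g 0 \<and> \<not> \<eta> x \<and> int (card {z. x \<le> z \<and> z < g 0 \<and> \<not> \<eta> z}) = \<bar>y\<bar>) = g y"
    proof (rule the_equality)
      show "g y < g 0 \<and> \<not> \<eta> (g y) \<and> int (card {z. g y \<le> z \<and> z < g 0 \<and> \<not> \<eta> z}) = \<bar>y\<bar>"
        using 3 hl by (simp add: dn ci lt)
      fix x assume x: "x < g 0 \<and> \<not> \<eta> x \<and> int (card {z. x \<le> z \<and> z < g 0 \<and> \<not> \<eta> z}) = \<bar>y\<bar>"
      then obtain j where "x = g j" using ex by blast
      with x 3 show "x = g y" by (auto simp: dn ci lt split: if_splits)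
    qed
    with 3 show ?thesis by (simp add: hole_def o)
  qed
qed

section \<open>Sets of holes unbounded in both directions\<close>

lemma infinite_int_less_iff: "infinite {x::int. x < 0 \<and> P x} \<longleftrightarrow> (\<forall>m. \<exists>x<m. P x)"
proof
  assume inf: "infinite {x. x < 0 \<and> P x}"
  show "\<forall>m. \<exists>x<m. P x"
  proof (rule ccontr)
    assume "\<not> (\<forall>m. \<exists>x<m. P x)"
    then obtain m where "\<forall>x<m. \<not> P x" by auto
    then have "{x. x < 0 \<and> P x} \<subseteq> {m..0}" by (auto simp: not_less[symmetric])
    with inf show False using finite_subset by blast
  qed
next
  assume R: "\<forall>m. \<exists>x<m. P x"
  show "infinite {x. x < 0 \<and> P x}"
  proof
    assume "finite {x. x < 0 \<and> P x}"
    then obtain b where b: "\<forall>x\<in>{x. x < 0 \<and> P x}. b \<le> x"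
      using bdd_below_finite unfolding bdd_below_def by blast
    obtain x where "x < min b 0" "P x" using R by blast
    with b show False by force
  qed
qed

lemma infinite_int_greater_iff: "infinite {x::int. x > 0 \<and> P x} \<longleftrightarrow> (\<forall>m. \<exists>x>m. P x)"
proof -
  have "{x. x > 0 \<and> P x} = uminus ` {x. x < 0 \<and> P (- x)}"
    by (auto intro!: image_eqI[where x = "- x" for x])
  then have "infinite {x. x > 0 \<and> P x} \<longleftrightarrow> infinite {x. x < 0 \<and> P (- x)}"
    by (simp add: finite_image_iff)
  also have "\<dots> \<longleftrightarrow> (\<forall>m. \<exists>x>m. P x)"
    unfolding infinite_int_less_iff by (metis minus_less_iff minus_minus)
  finally show ?thesis .
qed

lemma ergodic_UNIV_iff: "ergodic UNIV \<eta> \<longleftrightarrow> (\<forall>x. \<eta> x \<or> \<eta> (x + 1))"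
  by (auto simp: ergodic_def)

text \<open>Unboundedness in place of infinitude leaves only quantifiers over countable sets:
  measurability can be read off, and almost sure validity can be checked for each bound
  \<open>m\<close> separately.\<close>

lemma ergodic_inf_iff:
  "\<eta> \<in> ergodic_inf \<longleftrightarrow>
     (\<forall>x. \<eta> x \<or> \<eta> (x + 1)) \<and> (\<forall>m. \<exists>x<m. \<not> \<eta> x) \<and> (\<forall>m. \<exists>x>m. \<not> \<eta> x)"
  by (simp add: ergodic_inf_def ergodic_UNIV_iff infinite_int_less_iff infinite_int_greater_iff)

text \<open>The distances from the first hole at or left of 0 to the holes on its right and on its
  left form two infinite sets of naturals, whose enumerations are glued together. By
  \<open>hole_eqI\<close> the result is \<open>hole \<eta>\<close>.\<close>

lemma enumerates_hole:
  assumes "\<eta> \<in> ergodic_inf"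
  shows "enumerates (hole \<eta>) {x. \<not> \<eta> x}"
proof -
  have lo: "\<exists>x<m. \<not> \<eta> x" and hi: "\<exists>x>m. \<not> \<eta> x" for m
    using assms by (auto simp: ergodic_inf_iff)
  define S where "S = {n::nat. \<not> \<eta> (- int n)}"
  have S: "S \<noteq> {}"
  proof -
    obtain x where "x < 0" "\<not> \<eta> x" using lo by blast
    then have "nat (- x) \<in> S" by (simp add: S_def)
    then show ?thesis by blast
  qed
  define X where "X = - int (LEAST n. n \<in> S)"
  have X: "X \<le> 0" "\<not> \<eta> X" "\<And>z. X < z \<Longrightarrow> z \<le> 0 \<Longrightarrow> \<eta> z"
  proof -
    show "X \<le> 0" by (simp add: X_def)
    show "\<not> \<eta> X" using LeastI_ex[of "\<lambda>n. n \<in> S"] S by (auto simp: S_def X_def)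
    fix z assume "X < z" "z \<le> 0"
    then have "nat (- z) < (LEAST n. n \<in> S)" unfolding X_def by linarith
    then have "nat (- z) \<notin> S" by (rule not_less_Least)
    with \<open>z \<le> 0\<close> show "\<eta> z" by (simp add: S_def)
  qed
  \<comment> \<open>Both sets contain 0, the distance of \<open>X\<close> to itself, so the two
    branches of \<open>g\<close> meet at \<open>X\<close>.\<close>
  define U where "U = {n::nat. \<not> \<eta> (X + int n)}"
  define D where "D = {n::nat. \<not> \<eta> (X - int n)}"
  have infU: "infinite U"
    unfolding infinite_nat_iff_unbounded
  proof
    fix m
    obtain x where x: "x > X + int m" "\<not> \<eta> x" using hi by blast
    then have "nat (x - X) \<in> U" "m < nat (x - X)" by (auto simp: U_def)
    then show "\<exists>n>m. n \<in> U" by blast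
  qed
  have infD: "infinite D"
    unfolding infinite_nat_iff_unbounded
  proof
    fix m
    obtain x where x: "x < X - int m" "\<not> \<eta> x" using lo by blast
    then have "nat (X - x) \<in> D" "m < nat (X - x)" by (auto simp: D_def)
    then show "\<exists>n>m. n \<in> D" by blast
  qed
  have z: "enumerate U 0 = 0" "enumerate D 0 = 0"
    unfolding enumerate_0 using X(2) by (auto simp: U_def D_def intro!: Least_eq_0)
  define g where "g y = (if y \<ge> 0 then X + int (enumerate U (nat y))
                         else X - int (enumerate D (nat (- y))))" for y
  have g0: "g 0 = X" by (simp add: g_def z)
  have "strict_mono g"
  proof (rule strict_mono_int_step)
    fix y
    have a: "enumerate U (nat y) < enumerate U (nat (y + 1))" if "y \<ge> 0"
      using enumerate_mono[OF _ infU] that by simp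
    have b: "enumerate D (nat (- y - 1)) < enumerate D (nat (- y))" if "y < 0"
      using enumerate_mono[OF _ infD] that by simp
    consider "y \<ge> 0" | "y = -1" | "y < -1" by linarith
    then show "g y < g (y + 1)"
    proof cases
      case 1 then show ?thesis using a by (simp add: g_def)
    next
      case 2 then show ?thesis using b by (simp add: g_def z)
    next
      case 3
      then have "- (y + 1) = - y - 1" "\<not> 0 \<le> y" "\<not> 0 \<le> y + 1" by auto
      with b 3 show ?thesis by (simp only: g_def if_False) auto
    qed
  qed
  moreover have "range g = {x. \<not> \<eta> x}"
  proof (intro equalityI subsetI)
    fix x assume "x \<in> range g"
    then show "x \<in> {x. \<not> \<eta> x}"
      using enumerate_in_set[OF infU] enumerate_in_set[OF infD]
      by (auto simp: g_def U_def D_def)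
  next
    fix x assume "x \<in> {x. \<not> \<eta> x}"
    then have x: "\<not> \<eta> x" by simp
    show "x \<in> range g"
    proof (cases "x \<ge> X")
      case True
      then have "nat (x - X) \<in> U" using x by (simp add: U_def)
      then obtain n where "nat (x - X) = enumerate U n" using range_enumerate[OF infU] by (metis rangeE)
      then have "x = g (int n)" using True by (simp add: g_def)
      then show ?thesis by blast
    next
      case False
      then have "nat (X - x) \<in> D" using x by (simp add: D_def)
      then obtain n where n: "nat (X - x) = enumerate D n" using range_enumerate[OF infD] by (metis rangeE)
      \<comment> \<open>Index 0 of \<open>D\<close> stands for \<open>X\<close> itself;
        \<open>g\<close> uses \<open>D\<close> only for negative labels.\<close>
      then have "n \<noteq> 0" using False z by (metis diff_gt_0_iff_gt nat_0_iff not_le)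
      then have "x = g (- int n)" using False n by (simp add: g_def)
      then show ?thesis by blast
    qed
  qed
  moreover have "0 < g 1"
  proof (rule ccontr)
    assume "\<not> 0 < g 1"
    moreover have "X < g 1" using strict_monoD[OF \<open>strict_mono g\<close>, of 0 1] g0 by simp
    ultimately have "\<eta> (g 1)" using X(3) by simp
    then show False using \<open>range g = _\<close> by blast
  qed
  ultimately have "enumerates g {x. \<not> \<eta> x}" using X(1) g0 by (simp add: enumerates_def)
  with hole_eqI show ?thesis by metis
qed

section \<open>The inverse map\<close>

definition Psi_hole :: "(int \<Rightarrow> nat) \<times> int \<Rightarrow> int \<Rightarrow> int" where
  "Psi_hole p y = snd p + (if y \<ge> 0 then \<Sum>j\<in>{0..<y}. int (fst p j) + 2
                           else - (\<Sum>j\<in>{y..<0}. int (fst p j) + 2))"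

definition Psi :: "(int \<Rightarrow> nat) \<times> int \<Rightarrow> config" where
  "Psi p x \<longleftrightarrow> x \<notin> range (Psi_hole p)"

lemma Psi_hole_0 [simp]: "Psi_hole p 0 = snd p"
  by (simp add: Psi_hole_def)

lemma Psi_hole_succ: "Psi_hole p (y + 1) = Psi_hole p y + int (fst p y) + 2"
proof -
  \<comment> \<open>With half-open summation ranges, raising the label by one adds or removes the
    single term at \<open>y\<close>, on either side of 0.\<close>
  have "{0..<y + 1} = insert y {0..<y}" if "y \<ge> 0" using that by auto
  moreover have "{y..<0} = insert y {y + 1..<0}" if "y < 0" using that by auto
  ultimately show ?thesis
    by (cases "y \<ge> 0"; cases "y = -1") (auto simp: Psi_hole_def)
qed

lemma Psi_hole_pred: "Psi_hole p (y - 1) = Psi_hole p y - int (fst p (y - 1)) - 2"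
  using Psi_hole_succ[of p "y - 1"] by simp

lemma strict_mono_Psi_hole: "strict_mono (Psi_hole p)"
  by (rule strict_mono_int_step) (simp add: Psi_hole_succ)

text \<open>Membership in \<open>hat_E\<close> amounts to the normalisation in
  \<open>enumerates\<close>: it gives \<open>snd p \<le> 0\<close>, and label 1 sits at
  \<open>snd p + int (fst p 0) + 2\<close>, which is then at least 1.\<close>

lemma enumerates_Psi_hole:
  assumes "p \<in> hat_E"
  shows "enumerates (Psi_hole p) {x. \<not> Psi p x}"
  using assms strict_mono_Psi_hole Psi_hole_succ[of p 0]
  by (auto simp: enumerates_def Psi_def hat_E_def)

lemma hole_Psi: "p \<in> hat_E \<Longrightarrow> hole (Psi p) = Psi_hole p"
  by (rule hole_eqI) (rule enumerates_Psi_hole)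

lemma Psi_hole_ge: "int n \<le> Psi_hole p (int n) - snd p"
  by (induction n) (auto simp: Psi_hole_succ add.commute[of 1])

lemma Psi_hole_le: "Psi_hole p (- int n) - snd p \<le> - int n"
proof (induction n)
  case (Suc n)
  have "- int (Suc n) = - int n - 1" by simp
  then show ?case using Suc by (simp only: Psi_hole_pred)
qed auto

text \<open>Consecutive holes are at distance at least 2 by construction, and their positions grow
  at least linearly in the label in both directions.\<close>

lemma Psi_in_ergodic_inf: "Psi p \<in> ergodic_inf"
  unfolding ergodic_inf_iff
proof (intro conjI allI)
  fix x
  show "Psi p x \<or> Psi p (x + 1)"
  proof (rule ccontr)
    assume "\<not> ?thesis"
    then obtain i j where ij: "x = Psi_hole p i" "x + 1 = Psi_hole p j"
      by (auto simp: Psi_def)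
    then have "i < j" using strict_mono_less[OF strict_mono_Psi_hole, of p i j] by simp
    then have "Psi_hole p (i + 1) \<le> Psi_hole p j"
      using strict_mono_less_eq[OF strict_mono_Psi_hole] by simp
    with ij show False by (simp add: Psi_hole_succ)
  qed
next
  fix m
  have "Psi_hole p (- int (nat (snd p - m + 1))) < m"
    using Psi_hole_le[of p "nat (snd p - m + 1)"] Psi_hole_le[of p 0] by linarith
  then show "\<exists>x<m. \<not> Psi p x" by (auto simp: Psi_def)
  have "Psi_hole p (int (nat (m - snd p + 1))) > m"
    using Psi_hole_ge[of "nat (m - snd p + 1)" p] by linarith
  then show "\<exists>x>m. \<not> Psi p x" by (auto simp: Psi_def)
qed

lemma Pi_map_Psi: "p \<in> hat_E \<Longrightarrow> Pi_map (Psi p) = p"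
  by (cases p) (simp add: Pi_map_def hole_Psi Psi_hole_succ)

text \<open>Ergodicity excludes distance 1 between consecutive holes, so the \<open>nat\<close> in
  \<open>Pi_map\<close> is exact and \<open>hole\<close> obeys the same recursion as
  \<open>Psi_hole\<close>.\<close>

lemma hole_gap:
  assumes "\<eta> \<in> ergodic_inf"
  shows "hole \<eta> (y + 1) = hole \<eta> y + int (fst (Pi_map \<eta>) y) + 2"
proof -
  have e: "strict_mono (hole \<eta>)" "range (hole \<eta>) = {x. \<not> \<eta> x}"
    using enumerates_hole[OF assms] by (auto simp: enumerates_def)
  have "hole \<eta> y < hole \<eta> (y + 1)" using e(1) by (simp add: strict_mono_less)
  moreover have "hole \<eta> (y + 1) \<noteq> hole \<eta> y + 1"
    using assms e(2) by (metis (mono_tags) ergodic_inf_iff mem_Collect_eq rangeI)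
  ultimately show ?thesis by (simp add: Pi_map_def)
qed

lemma Psi_hole_Pi_map:
  assumes "\<eta> \<in> ergodic_inf"
  shows "Psi_hole (Pi_map \<eta>) y = hole \<eta> y"
proof (induction y rule: int_induct[of _ 0])
  case base
  then show ?case by (simp add: Pi_map_def)
next
  case (step1 i)
  then show ?case by (simp add: Psi_hole_succ hole_gap[OF assms])
next
  case (step2 i)
  then show ?case using hole_gap[OF assms, of "i - 1"] by (simp add: Psi_hole_pred)
qed

lemma Psi_Pi_map:
  assumes "\<eta> \<in> ergodic_inf"
  shows "Psi (Pi_map \<eta>) = \<eta>"
  using enumerates_hole[OF assms] Psi_hole_Pi_map[OF assms]
  by (auto simp: fun_eq_iff Psi_def enumerates_def set_eq_iff)

lemma Pi_map_in_hat_E: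
  assumes "\<eta> \<in> ergodic_inf"
  shows "Pi_map \<eta> \<in> hat_E"
  using enumerates_hole[OF assms] hole_gap[OF assms, of 0]
  by (auto simp: hat_E_def Pi_map_def enumerates_def)

lemma the_inv_into_Pi_map:
  assumes "p \<in> hat_E"
  shows "the_inv_into ergodic_inf Pi_map p = Psi p"
proof -
  have "inj_on Pi_map ergodic_inf" by (metis inj_onI Psi_Pi_map)
  then show ?thesis using the_inv_into_f_f[OF _ Psi_in_ergodic_inf] Pi_map_Psi[OF assms] by metis
qed

section \<open>Cylinders as events on an interval\<close>

definition cyl :: "nat \<Rightarrow> (int \<Rightarrow> nat) \<times> int \<Rightarrow> ((int \<Rightarrow> nat) \<times> int) set" where
  "cyl n p = {q \<in> hat_E. (\<forall>y\<in>{- int n..int n}. fst q y = fst p y) \<and> snd q = snd p}"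

lemma Psi_hole_cong_cyl:
  assumes "q \<in> cyl n p" "- int n \<le> y" "y \<le> int n + 1"
  shows "Psi_hole q y = Psi_hole p y"
  using assms by (auto simp: Psi_hole_def cyl_def intro!: sum.cong)

text \<open>From left to right, monotonicity shows that the holes in the interval are exactly those
  with labels from \<open>- n\<close> to \<open>n + 1\<close>, and these agree. From right to left
  only positions are known: label 0 is matched first by means of the origin, then agreement spreads
  hole by hole in both directions.\<close>

lemma Pi_map_in_cyl_iff:
  assumes "\<eta> \<in> ergodic_inf" "p \<in> hat_E"
  shows "Pi_map \<eta> \<in> cyl n p \<longleftrightarrow>
    (\<forall>z\<in>{Psi_hole p (- int n)..Psi_hole p (int n + 1)}. \<eta> z = Psi p z)"
proof
  assume c: "Pi_map \<eta> \<in> cyl n p"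
  have g: "hole \<eta> y = Psi_hole p y" if "- int n \<le> y" "y \<le> int n + 1" for y
    using Psi_hole_cong_cyl[OF c that] Psi_hole_Pi_map[OF assms(1)] by simp
  have e: "strict_mono (hole \<eta>)" "range (hole \<eta>) = {x. \<not> \<eta> x}"
    using enumerates_hole[OF assms(1)] by (auto simp: enumerates_def)
  show "\<forall>z\<in>{Psi_hole p (- int n)..Psi_hole p (int n + 1)}. \<eta> z = Psi p z"
  proof
    fix z assume z: "z \<in> {Psi_hole p (- int n)..Psi_hole p (int n + 1)}"
    have "\<not> Psi p z" if "\<not> \<eta> z"
    proof -
      obtain j where j: "z = hole \<eta> j" using \<open>\<not> \<eta> z\<close> e(2) by blast
      have "- int n \<le> j" "j \<le> int n + 1"
        using z j g[of "- int n", symmetric] g[of "int n + 1", symmetric] strict_mono_less_eq[OF e(1)]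
        by auto
      then show ?thesis using j g by (auto simp: Psi_def)
    qed
    moreover have "\<not> \<eta> z" if "\<not> Psi p z"
    proof -
      obtain j where j: "z = Psi_hole p j" using \<open>\<not> Psi p z\<close> by (auto simp: Psi_def)
      have "- int n \<le> j" "j \<le> int n + 1"
        using z j strict_mono_less_eq[OF strict_mono_Psi_hole] by auto
      then show ?thesis using j g[of j] e(2) rangeI[of "hole \<eta>" j] by simp
    qed
    ultimately show "\<eta> z = Psi p z" by blast
  qed
next
  assume a: "\<forall>z\<in>{Psi_hole p (- int n)..Psi_hole p (int n + 1)}. \<eta> z = Psi p z"
  have en: "enumerates (hole \<eta>) {x. \<not> \<eta> x}" using enumerates_hole[OF assms(1)] .
  then have e: "strict_mono (hole \<eta>)" "range (hole \<eta>) = {x. \<not> \<eta> x}"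
    by (auto simp: enumerates_def)
  note le = strict_mono_less_eq[OF strict_mono_Psi_hole, of p]
  note lt = strict_mono_less[OF strict_mono_Psi_hole, of p]
  have hl: "\<not> \<eta> (Psi_hole p y)" if "- int n \<le> y" "y \<le> int n + 1" for y
    using a that by (auto simp: le Psi_def)
  have gap: "\<eta> z" if "Psi_hole p y < z" "z < Psi_hole p (y + 1)" "- int n \<le> y" "y \<le> int n" for y z
  proof -
    have "Psi p z" using that by (auto simp: lt Psi_def)
    moreover have "Psi_hole p (- int n) \<le> Psi_hole p y" "Psi_hole p (y + 1) \<le> Psi_hole p (int n + 1)"
      using that by (auto simp: le)
    ultimately show ?thesis using a that by auto
  qed
  have p0: "snd p \<le> 0" "0 < Psi_hole p 1"
    using enumerates_Psi_hole[OF assms(2)] by (auto simp: enumerates_def)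
  \<comment> \<open>The interval contains the hole \<open>snd p \<le> 0\<close> and the next hole
    \<open>Psi_hole p 1 > 0\<close>, with occupied sites in between. Hence \<open>snd p\<close> is
    the last hole of \<eta> at or left of the origin.\<close>
  have h0: "hole \<eta> 0 = Psi_hole p 0"
  proof -
    have "\<not> hole \<eta> 0 < snd p"
    proof
      assume "hole \<eta> 0 < snd p"
      moreover have "\<not> \<eta> (snd p)" using hl[of 0] by simp
      then obtain j where "snd p = hole \<eta> j" using e(2) by blast
      ultimately have "0 < j" "hole \<eta> j \<le> 0" using p0 strict_mono_less[OF e(1)] by auto
      then have "hole \<eta> 1 \<le> hole \<eta> j" using strict_mono_less_eq[OF e(1)] by simp
      with \<open>hole \<eta> j \<le> 0\<close> en show False by (auto simp: enumerates_def)
    qed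
    moreover have "\<not> snd p < hole \<eta> 0"
    proof
      assume "snd p < hole \<eta> 0"
      then have "\<eta> (hole \<eta> 0)" using gap[of 0 "hole \<eta> 0"] p0 en by (auto simp: enumerates_def)
      then show False using e(2) by blast
    qed
    ultimately show ?thesis by simp
  qed
  \<comment> \<open>Upwards the labels run to \<open>n + 1\<close>, downwards only to
    \<open>n\<close>, since the gap with index \<open>n\<close> ends at label
    \<open>n + 1\<close>.\<close>
  have up: "m \<le> n + 1 \<Longrightarrow> hole \<eta> (int m) = Psi_hole p (int m)" for m
  proof (induction m)
    case (Suc m)
    then have IH: "hole \<eta> (int m) = Psi_hole p (int m)" by simp
    have "Psi_hole p (int m + 1) = hole \<eta> (int m + 1)"
      by (rule enumerates_succ[OF e])
        (use IH Suc.prems hl[of "int m + 1"] gap[of "int m"] in \<open>auto simp: lt\<close>)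
    then show ?case by (simp add: add.commute)
  qed (simp add: h0)
  have dn: "m \<le> n \<Longrightarrow> hole \<eta> (- int m) = Psi_hole p (- int m)" for m
  proof (induction m)
    case (Suc m)
    then have IH: "hole \<eta> (- int m) = Psi_hole p (- int m)" by simp
    have "Psi_hole p (- int m - 1) = hole \<eta> (- int m - 1)"
      by (rule enumerates_pred[OF e])
        (use IH Suc.prems hl[of "- int m - 1"] gap[of "- int m - 1"] in \<open>auto simp: lt\<close>)
    moreover have "- int (Suc m) = - int m - 1" by simp
    ultimately show ?case by (simp only:)
  qed (simp add: h0)
  have eq: "hole \<eta> y = Psi_hole p y" if "- int n \<le> y" "y \<le> int n + 1" for y
    using up[of "nat y"] dn[of "nat (- y)"] that by (cases "y \<ge> 0") auto
  show "Pi_map \<eta> \<in> cyl n p"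
    unfolding cyl_def
  proof (intro CollectI conjI ballI)
    show "Pi_map \<eta> \<in> hat_E" by (rule Pi_map_in_hat_E[OF assms(1)])
    show "snd (Pi_map \<eta>) = snd p" by (simp add: Pi_map_def h0)
    fix y assume "y \<in> {- int n..int n}"
    then show "fst (Pi_map \<eta>) y = fst p y"
      using eq[of y] eq[of "y + 1"] by (simp add: Pi_map_def Psi_hole_succ)
  qed
qed

section \<open>Cylinders and measurability\<close>

lemma space_config_space [simp]: "space config_space = UNIV"
  by (simp add: config_space_def space_PiM)

lemma measurable_config_coordinate [measurable]:
  "(\<lambda>\<eta>. \<eta> x) \<in> config_space \<rightarrow>\<^sub>M count_space UNIV"
  unfolding config_space_def by (rule measurable_component_singleton) simp

lemma measurable_into_config_space:
  assumes "\<And>x. (\<lambda>p. f p x) \<in> M \<rightarrow>\<^sub>M count_space UNIV"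
  shows "f \<in> M \<rightarrow>\<^sub>M config_space"
  unfolding config_space_def using assms
  by (intro measurable_PiM_single'[where f = "\<lambda>x p. f p x", simplified]) auto

lemma ergodic_inf_sets: "ergodic_inf \<in> sets config_space"
proof -
  have "ergodic_inf = {\<eta> \<in> space config_space.
     (\<forall>x. \<eta> x \<or> \<eta> (x + 1)) \<and> (\<forall>m. \<exists>x\<in>{..<m}. \<not> \<eta> x) \<and> (\<forall>m. \<exists>x\<in>{m<..}. \<not> \<eta> x)}"
    using ergodic_inf_iff by (auto simp: Bex_def)
  also have "\<dots> \<in> sets config_space"
    by measurable
  finally show ?thesis .
qed

lemma interval_sets: "{\<eta>. \<forall>x\<in>{a..b}. \<eta> x = \<xi> x} \<in> sets config_space"
proof -
  have "{\<eta> \<in> space config_space. \<forall>x\<in>{a..b}. \<eta> x = \<xi> x} \<in> sets config_space"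
    by measurable
  then show ?thesis by simp
qed

section \<open>Generators of the \<sigma>-algebra on the image side\<close>

definition cyls :: "((int \<Rightarrow> nat) \<times> int) set set" where
  "cyls = insert {} {cyl n p | n p. p \<in> hat_E}"

lemma cyl_self: "p \<in> hat_E \<Longrightarrow> p \<in> cyl n p"
  by (simp add: cyl_def)

lemma cyl_in_cyls: "p \<in> hat_E \<Longrightarrow> cyl n p \<in> cyls"
  unfolding cyls_def by blast

text \<open>Every member of a cylinder can serve as its centre, as with balls in an ultrametric
  space.\<close>

lemma cyl_cong: "q \<in> cyl n p \<Longrightarrow> m \<le> n \<Longrightarrow> cyl m q = cyl m p"
  by (auto simp: cyl_def)

lemma cyls_Pow: "cyls \<subseteq> Pow hat_E"
  by (auto simp: cyls_def cyl_def)

text \<open>Two cylinders with a common point can be recentred there and are then nested. Disjoint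
  ones are the reason for including the empty set in \<open>cyls\<close>.\<close>

lemma Int_stable_cyls: "Int_stable cyls"
proof (rule Int_stableI)
  fix A B assume AB: "A \<in> cyls" "B \<in> cyls"
  show "A \<inter> B \<in> cyls"
  proof (cases "A \<inter> B = {}")
    case False
    then obtain q where q: "q \<in> A" "q \<in> B" by blast
    with AB obtain n p m r where A: "A = cyl n p" and B: "B = cyl m r"
      by (auto simp: cyls_def)
    have "A = cyl n q" "B = cyl m q" using q A B cyl_cong by blast+
    moreover have "cyl n q \<inter> cyl m q = cyl (max n m) q"
      by (auto simp: cyl_def max_def)
    moreover have "q \<in> hat_E" using q A by (auto simp: cyl_def)
    ultimately show ?thesis using cyl_in_cyls by simp
  qed (simp add: cyls_def)
qed

lemma countable_cyls: "countable cyls"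
proof -
  define F where "F n = {- int n..int n} \<rightarrow>\<^sub>E (UNIV :: nat set)" for n
  have "cyls \<subseteq> insert {} (\<Union>n. \<Union>x. (\<lambda>k. cyl n (k, x)) ` F n)"
  proof
    fix C assume "C \<in> cyls"
    then consider "C = {}" | n p where "C = cyl n p" by (auto simp: cyls_def)
    then show "C \<in> insert {} (\<Union>n. \<Union>x. (\<lambda>k. cyl n (k, x)) ` F n)"
    proof cases
      case (2 n p)
      \<comment> \<open>Restriction to the window picks a representative from a countable set of
        functions without changing the cylinder.\<close>
      have "C = cyl n (restrict (fst p) {- int n..int n}, snd p)" by (auto simp: 2 cyl_def)
      moreover have "restrict (fst p) {- int n..int n} \<in> F n" by (auto simp: F_def)
      ultimately show ?thesis by blast
    qed simp
  qed
  moreover have "countable (F n)" for n unfolding F_def by (rule countable_PiE) auto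
  then have "countable (insert {} (\<Union>n. \<Union>x. (\<lambda>k. cyl n (k, x)) ` F n))" by auto
  ultimately show ?thesis by (rule countable_subset)
qed

lemma Union_cyls: "\<Union>cyls = hat_E"
proof
  show "\<Union>cyls \<subseteq> hat_E" using cyls_Pow by blast
  show "hat_E \<subseteq> \<Union>cyls"
  proof
    fix p :: "(int \<Rightarrow> nat) \<times> int"
    assume "p \<in> hat_E"
    then have "cyl 0 p \<in> cyls" "p \<in> cyl 0 p" by (auto intro: cyl_in_cyls cyl_self)
    then show "p \<in> \<Union>cyls" by blast
  qed
qed

text \<open>Such sets are the open sets for the base of cylinders. As the base is countable, each is
  a countable union of cylinders. Measurability is thereby reduced to local constancy.\<close>

lemma in_sigma_cyls:
  assumes "A \<subseteq> hat_E" "\<And>p. p \<in> A \<Longrightarrow> \<exists>n. cyl n p \<subseteq> A"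
  shows "A \<in> sigma_sets hat_E cyls"
proof -
  have "A = \<Union>{C \<in> cyls. C \<subseteq> A}"
  proof (intro equalityI subsetI)
    fix p assume "p \<in> A"
    with assms obtain n where "cyl n p \<subseteq> A" by blast
    moreover have "p \<in> hat_E" using \<open>p \<in> A\<close> assms by blast
    then have "cyl n p \<in> cyls" "p \<in> cyl n p" by (auto intro: cyl_in_cyls cyl_self)
    ultimately show "p \<in> \<Union>{C \<in> cyls. C \<subseteq> A}" by blast
  qed blast
  moreover have "\<Union>{C \<in> cyls. C \<subseteq> A} \<in> sigma_sets hat_E cyls"
    by (rule sigma_sets_UNION) (use countable_cyls in \<open>auto intro: countable_subset\<close>)
  ultimately show ?thesis by simp
qed

lemma space_hat_space [simp]: "space hat_space = hat_E"
  by (simp add: hat_space_def space_restrict_space space_pair_measure space_PiM)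

text \<open>For one inclusion the coordinates are measurable with respect to the generated
  \<sigma>-algebra, being constant on small cylinders. For the other, a cylinder is given by
  finitely many coordinate conditions.\<close>

lemma sets_hat_space: "sets hat_space = sigma_sets hat_E cyls"
proof
  let ?P = "Pi\<^sub>M UNIV (\<lambda>_. count_space UNIV) \<Otimes>\<^sub>M count_space UNIV :: ((int \<Rightarrow> nat) \<times> int) measure"
  have sp: "space ?P = UNIV" by (simp add: space_pair_measure space_PiM)
  have sP: "space (sigma hat_E cyls) = hat_E" "sets (sigma hat_E cyls) = sigma_sets hat_E cyls"
    using cyls_Pow by auto
  have m: "(\<lambda>p. p) \<in> sigma hat_E cyls \<rightarrow>\<^sub>M ?P"
  proof (rule measurable_pair)
    have "(\<lambda>p. fst p y) \<in> sigma hat_E cyls \<rightarrow>\<^sub>M count_space UNIV" for y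
    proof -
      \<comment> \<open>The radius \<open>nat \<bar>y\<bar>\<close> puts \<open>y\<close> into the
        window.\<close>
      have "{p \<in> hat_E. fst p y = c} \<in> sigma_sets hat_E cyls" for c
        by (rule in_sigma_cyls) (auto simp: cyl_def intro!: exI[of _ "nat \<bar>y\<bar>"] dest!: bspec[where x = y])
      moreover have "(\<lambda>p. fst p y) -` {c} \<inter> hat_E = {p \<in> hat_E. fst p y = c}" for c
        by auto
      ultimately show ?thesis by (simp add: measurable_count_space_eq_countable sP)
    qed
    then have "(\<lambda>p y. fst p y) \<in> sigma hat_E cyls \<rightarrow>\<^sub>M Pi\<^sub>M UNIV (\<lambda>_. count_space UNIV)"
      by (rule measurable_PiM_single') auto
    then show "fst \<circ> (\<lambda>p. p) \<in> sigma hat_E cyls \<rightarrow>\<^sub>M Pi\<^sub>M UNIV (\<lambda>_. count_space UNIV)"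
      by (simp add: comp_def)
    show "snd \<circ> (\<lambda>p. p) \<in> sigma hat_E cyls \<rightarrow>\<^sub>M count_space UNIV"
    proof -
      have "{p \<in> hat_E. snd p = c} \<in> sigma_sets hat_E cyls" for c
        by (rule in_sigma_cyls) (auto simp: cyl_def)
      moreover have "snd -` {c} \<inter> hat_E = {p \<in> hat_E. snd p = c}" for c
        by auto
      ultimately show ?thesis by (simp add: measurable_count_space_eq_countable sP comp_def)
    qed
  qed
  show "sets hat_space \<subseteq> sigma_sets hat_E cyls"
  proof
    fix A assume "A \<in> sets hat_space"
    then obtain B where B: "B \<in> sets ?P" "A = hat_E \<inter> B"
      by (auto simp: hat_space_def sets_restrict_space)
    have "(\<lambda>p. p) -` B \<inter> space (sigma hat_E cyls) \<in> sets (sigma hat_E cyls)"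
      using m B(1) by (rule measurable_sets)
    then show "A \<in> sigma_sets hat_E cyls" unfolding sP B(2) by (simp add: Int_commute)
  qed
  have "cyl n p \<in> sets hat_space" for n p
  proof -
    have "{q \<in> space ?P. (\<forall>y\<in>{- int n..int n}. fst q y = fst p y) \<and> snd q = snd p} \<in> sets ?P"
      by measurable
    moreover have "cyl n p = hat_E \<inter>
      {q \<in> space ?P. (\<forall>y\<in>{- int n..int n}. fst q y = fst p y) \<and> snd q = snd p}"
      by (auto simp: cyl_def sp)
    ultimately show ?thesis by (auto simp: hat_space_def sets_restrict_space)
  qed
  then have "cyls \<subseteq> sets hat_space" by (auto simp: cyls_def)
  then show "sigma_sets hat_E cyls \<subseteq> sets hat_space"
    using sets.sigma_sets_subset[of cyls hat_space] by simp
qed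

lemma hat_setsI:
  assumes "A \<subseteq> hat_E" "\<And>p. p \<in> A \<Longrightarrow> \<exists>n. cyl n p \<subseteq> A"
  shows "A \<in> sets hat_space"
  using in_sigma_cyls[OF assms] by (simp add: sets_hat_space)

lemma cyl_sets: "p \<in> hat_E \<Longrightarrow> cyl n p \<in> sets hat_space"
  unfolding sets_hat_space by (rule sigma_sets.Basic) (rule cyl_in_cyls)

section \<open>Measurability of both maps\<close>

lemma measurable_Psi: "Psi \<in> hat_space \<rightarrow>\<^sub>M config_space"
proof (rule measurable_into_config_space)
  fix x
  \<comment> \<open>A hole at \<open>x\<close> is certified by a single label \<open>y\<close>,
    whose position is fixed on the cylinder of radius \<open>nat \<bar>y\<bar>\<close> around
    \<open>p\<close>.\<close>
  have "{p \<in> hat_E. \<not> Psi p x} \<in> sets hat_space"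
  proof (rule hat_setsI)
    fix p assume "p \<in> {p \<in> hat_E. \<not> Psi p x}"
    then obtain y where y: "Psi_hole p y = x" by (auto simp: Psi_def)
    have "cyl (nat \<bar>y\<bar>) p \<subseteq> {p \<in> hat_E. \<not> Psi p x}"
    proof
      fix q assume q: "q \<in> cyl (nat \<bar>y\<bar>) p"
      then have "Psi_hole q y = x" using Psi_hole_cong_cyl[OF q, of y] y by auto
      then show "q \<in> {p \<in> hat_E. \<not> Psi p x}" using q by (auto simp: Psi_def cyl_def)
    qed
    then show "\<exists>n. cyl n p \<subseteq> {p \<in> hat_E. \<not> Psi p x}" by blast
  qed auto
  then have "Measurable.pred hat_space (\<lambda>p. \<not> Psi p x)" by (simp add: pred_def)
  then have "Measurable.pred hat_space (\<lambda>p. \<not> \<not> Psi p x)" by (rule pred_intros_logic)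
  then show "(\<lambda>p. Psi p x) \<in> hat_space \<rightarrow>\<^sub>M count_space UNIV" by simp
qed

lemma measurable_Pi_map: "Pi_map \<in> restrict_space config_space ergodic_inf \<rightarrow>\<^sub>M hat_space"
proof (rule measurable_sigma_sets[OF sets_hat_space cyls_Pow])
  show "Pi_map \<in> space (restrict_space config_space ergodic_inf) \<rightarrow> hat_E"
    using Pi_map_in_hat_E by (auto simp: space_restrict_space)
  fix C assume "C \<in> cyls"
  then consider "C = {}" | n p where "C = cyl n p" "p \<in> hat_E" by (auto simp: cyls_def)
  then show "Pi_map -` C \<inter> space (restrict_space config_space ergodic_inf)
      \<in> sets (restrict_space config_space ergodic_inf)"
  proof cases
    case (2 n p)
    have "Pi_map -` C \<inter> space (restrict_space config_space ergodic_inf) = ergodic_inf \<inter>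
      {\<eta>. \<forall>z\<in>{Psi_hole p (- int n)..Psi_hole p (int n + 1)}. \<eta> z = Psi p z}"
      unfolding 2(1) space_restrict_space space_config_space
      using Pi_map_in_cyl_iff[OF _ 2(2), of _ n] by blast
    then show ?thesis using interval_sets by (auto simp: sets_restrict_space)
  qed simp
qed

section \<open>The stationary measure on cylinders\<close>

lemma sets_is_pi: "is_pi \<rho> P \<Longrightarrow> sets P = sets config_space"
  by (simp add: is_pi_def)

lemma space_is_pi: "is_pi \<rho> P \<Longrightarrow> space P = UNIV"
  using sets_eq_imp_space_eq[OF sets_is_pi] by simp

lemma measurable_Pi_map_is_pi:
  assumes "is_pi \<rho> P"
  shows "Pi_map \<in> restrict_space P ergodic_inf \<rightarrow>\<^sub>M hat_space"
  using measurable_Pi_map measurable_cong_sets[OF sets_restrict_space_cong[OF sets_is_pi[OF assms]] refl]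
  by blast

text \<open>A shift by \<open>a - 1\<close> moves the interval onto \<open>{1..b - a + 1}\<close>,
  where the marginal formula applies.\<close>

lemma is_pi_interval:
  assumes P: "is_pi \<rho> P" and "a \<le> b"
  shows "measure P {\<eta>. \<forall>z\<in>{a..b}. \<eta> z = \<xi> z}
           = pi_marginal \<rho> (b - a + 1) (\<lambda>z. \<xi> (z + (a - 1)))"
proof -
  note sP = sets_is_pi[OF P] and spP = space_is_pi[OF P]
  define A where "A = {\<eta>. \<forall>z\<in>{1..b - a + 1}. \<eta> z = \<xi> (z + (a - 1))}"
  have A: "A \<in> sets config_space" unfolding A_def by (rule interval_sets)
  have m: "(\<lambda>\<eta> x. \<eta> (x + (a - 1))) \<in> P \<rightarrow>\<^sub>M config_space"
    unfolding measurable_cong_sets[OF sP refl] by (rule measurable_into_config_space) simp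
  have "measure P A = measure (distr P config_space (\<lambda>\<eta> x. \<eta> (x + (a - 1)))) A"
    using P by (simp add: is_pi_def translation_invariant_def)
  also have "\<dots> = measure P ((\<lambda>\<eta> x. \<eta> (x + (a - 1))) -` A \<inter> space P)"
    by (rule measure_distr[OF m A])
  also have "(\<lambda>\<eta> x. \<eta> (x + (a - 1))) -` A \<inter> space P = {\<eta>. \<forall>z\<in>{a..b}. \<eta> z = \<xi> z}"
  proof -
    have img: "(\<lambda>z. z + (a - 1)) ` {1..b - a + 1} = {a..b}"
      by (subst image_add_atLeastAtMost') simp
    show ?thesis unfolding A_def spP img[symmetric] by blast
  qed
  finally have "measure P {\<eta>. \<forall>z\<in>{a..b}. \<eta> z = \<xi> z} = measure P A" ..
  also have "\<dots> = pi_marginal \<rho> (b - a + 1) (\<lambda>z. \<xi> (z + (a - 1)))"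
    using P \<open>a \<le> b\<close> by (simp add: is_pi_def A_def spP)
  finally show ?thesis .
qed

text \<open>With all \<open>n + 1\<close> sites occupied, the first exponent is -1, which turns the
  prefactor \<open>1 - \<rho>\<close> into \<rho>, and the second is \<open>n\<close>.\<close>

lemma pi_marginal_full:
  assumes "0 < \<rho>" "\<rho> < 1"
  shows "pi_marginal \<rho> (int n + 1) (\<lambda>_. True) = \<rho> * a_param \<rho> ^ n"
proof -
  have "ergodic {1..int n + 1} (\<lambda>_. True)" by (simp add: ergodic_def)
  then show ?thesis using assms
    by (simp add: pi_marginal_def a_param_def power_int_minus)
qed

lemma a_param_bounds:
  assumes "1/2 < \<rho>" "\<rho> < 1"
  shows "0 < a_param \<rho>" "a_param \<rho> < 1" "1 - a_param \<rho> = (1 - \<rho>) / \<rho>"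
  using assms by (auto simp: a_param_def field_simps)

text \<open>A half-line without holes contains fully occupied boxes of every length, whose
  probabilities tend to 0, and only countably many half-lines have to be excluded.\<close>

lemma AE_ergodic_inf:
  assumes \<rho>: "1/2 < \<rho>" "\<rho> < 1" and P: "is_pi \<rho> P"
  shows "AE \<eta> in P. \<eta> \<in> ergodic_inf"
proof -
  interpret prob_space P using P by (simp add: is_pi_def)
  note sP = sets_is_pi[OF P] and spP = space_is_pi[OF P]
  have pred: "{\<eta>. Q \<eta>} \<in> sets P" if "Measurable.pred config_space Q" for Q
    using that sP by (simp add: pred_def)
  \<comment> \<open>The left end \<open>f n\<close> may move with the length: the boxes grow
    leftwards from \<open>m - 1\<close> in one application and rightwards from \<open>m + 1\<close>
    in the other.\<close>
  have null: "AE \<eta> in P. \<not> Q \<eta>"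
    if Q: "Measurable.pred config_space Q" "\<And>n \<eta> z. Q \<eta> \<Longrightarrow> z \<in> {f n..f n + int n} \<Longrightarrow> \<eta> z"
    for Q and f :: "nat \<Rightarrow> int"
  proof -
    have "prob {\<eta>. Q \<eta>} \<le> \<rho> * a_param \<rho> ^ n" for n
    proof -
      have "\<eta> z = True" if "Q \<eta>" "z \<in> {f n..f n + int n}" for \<eta> z
        using Q(2)[OF that] by simp
      then have "{\<eta>. Q \<eta>} \<subseteq> {\<eta>. \<forall>z\<in>{f n..f n + int n}. \<eta> z = True}" by blast
      then have "prob {\<eta>. Q \<eta>} \<le> prob {\<eta>. \<forall>z\<in>{f n..f n + int n}. \<eta> z = True}"
        by (rule finite_measure_mono) (use interval_sets[of _ _ "\<lambda>_. True"] sP in auto)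
      also have "\<dots> = \<rho> * a_param \<rho> ^ n"
        using is_pi_interval[OF P, of "f n" "f n + int n" "\<lambda>_. True"]
          pi_marginal_full[of \<rho> n] \<rho> by simp
      finally show ?thesis .
    qed
    moreover have "(\<lambda>n. \<rho> * a_param \<rho> ^ n) \<longlonglongrightarrow> \<rho> * 0"
      using a_param_bounds[OF \<rho>] by (intro tendsto_intros LIMSEQ_realpow_zero) auto
    ultimately have "prob {\<eta>. Q \<eta>} \<le> 0"
      by (intro LIMSEQ_le_const[of _ 0]) auto
    then have "prob {\<eta>. Q \<eta>} = 0" by (simp add: measure_le_0_iff)
    then have "emeasure P {\<eta>. Q \<eta>} = 0" by (simp add: emeasure_eq_measure)
    then show ?thesis using pred[OF Q(1)] by (subst AE_iff_measurable) (auto simp: spP)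
  qed
  have pr: "Measurable.pred config_space (\<lambda>\<eta>. \<forall>x\<in>S. \<eta> x)" for S :: "int set"
  proof -
    have "Measurable.pred config_space (\<lambda>\<eta>. \<forall>x\<in>S. \<eta> x = True)" by measurable
    then show ?thesis by simp
  qed
  have "AE \<eta> in P. \<not> (\<forall>x\<in>{..<m}. \<eta> x)" for m
    by (rule null[OF _, of _ "\<lambda>n. m - 1 - int n"]) (use pr in auto)
  then have "AE \<eta> in P. \<forall>m. \<not> (\<forall>x\<in>{..<m}. \<eta> x)" by (simp add: AE_all_countable)
  moreover have "AE \<eta> in P. \<not> (\<forall>x\<in>{m<..}. \<eta> x)" for m
    by (rule null[OF _, of _ "\<lambda>n. m + 1"]) (use pr in auto)
  then have "AE \<eta> in P. \<forall>m. \<not> (\<forall>x\<in>{m<..}. \<eta> x)" by (simp add: AE_all_countable)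
  moreover have "AE \<eta> in P. ergodic UNIV \<eta>" using P by (simp add: is_pi_def)
  ultimately show ?thesis
    by eventually_elim (auto simp: ergodic_inf_iff ergodic_UNIV_iff)
qed

section \<open>The weight of the pattern fixed by a cylinder\<close>

lemma Psi_hole_span:
  "Psi_hole p (int n + 1) - Psi_hole p (- int n)
     = int (\<Sum>y\<in>{- int n..int n}. fst p y) + 2 * (2 * int n + 1)"
proof (induction n)
  case 0
  show ?case by (simp add: Psi_hole_succ[of p 0, simplified])
next
  case (Suc n)
  have "{- int (Suc n)..int (Suc n)} = insert (- int n - 1) (insert (int n + 1) {- int n..int n})"
    by auto
  then have "(\<Sum>y\<in>{- int (Suc n)..int (Suc n)}. fst p y)
      = fst p (- int n - 1) + fst p (int n + 1) + (\<Sum>y\<in>{- int n..int n}. fst p y)"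
    by simp
  moreover have "- int (Suc n) = - int n - 1" "int (Suc n) + 1 = int n + 1 + 1" by auto
  ultimately show ?case using Suc
    by (simp only: Psi_hole_pred Psi_hole_succ[of p "int n + 1"]) simp
qed

lemma pi_marginal_Psi:
  assumes "1/2 < \<rho>" "\<rho> < 1"
  shows "pi_marginal \<rho> (Psi_hole p (int n + 1) - Psi_hole p (- int n) + 1)
      (\<lambda>z. Psi p (z + (Psi_hole p (- int n) - 1)))
     = (1 - \<rho>) * (1 - a_param \<rho>) ^ (2 * n + 1) * a_param \<rho> ^ (\<Sum>y\<in>{- int n..int n}. fst p y)"
proof -
  \<comment> \<open>The shift by \<open>c\<close> puts the leftmost hole of the pattern at site 1
    and the rightmost at site \<open>l\<close>.\<close>
  define c where "c = Psi_hole p (- int n) - 1"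
  define l where "l = Psi_hole p (int n + 1) - Psi_hole p (- int n) + 1"
  define K where "K = (\<Sum>y\<in>{- int n..int n}. fst p y)"
  have l: "l = int K + 4 * int n + 3" using Psi_hole_span[of p n] by (simp add: l_def K_def)
  have erg: "ergodic {1..l} (\<lambda>z. Psi p (z + c))"
  proof -
    have "Psi p (z + c) \<or> Psi p (z + 1 + c)" for z
      using Psi_in_ergodic_inf[of p] unfolding ergodic_inf_iff by (metis add.commute add.left_commute)
    then show ?thesis by (auto simp: ergodic_def)
  qed
  have "{z\<in>{1..l}. \<not> Psi p (z + c)} = (\<lambda>y. Psi_hole p y - c) ` {- int n..int n + 1}"
  proof (intro equalityI subsetI)
    fix z assume z: "z \<in> {z\<in>{1..l}. \<not> Psi p (z + c)}"
    then obtain y where y: "z + c = Psi_hole p y" by (auto simp: Psi_def)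
    then have "Psi_hole p (- int n) \<le> Psi_hole p y" "Psi_hole p y \<le> Psi_hole p (int n + 1)"
      using z by (auto simp: c_def l_def)
    then have "y \<in> {- int n..int n + 1}" by (simp add: strict_mono_less_eq[OF strict_mono_Psi_hole])
    with y show "z \<in> (\<lambda>y. Psi_hole p y - c) ` {- int n..int n + 1}"
      by (intro image_eqI[of _ _ y]) auto
  next
    fix z assume "z \<in> (\<lambda>y. Psi_hole p y - c) ` {- int n..int n + 1}"
    then obtain y where y: "z = Psi_hole p y - c" "- int n \<le> y" "y \<le> int n + 1" by auto
    then have "Psi_hole p (- int n) \<le> Psi_hole p y" "Psi_hole p y \<le> Psi_hole p (int n + 1)"
      by (simp_all add: strict_mono_less_eq[OF strict_mono_Psi_hole])
    with y show "z \<in> {z\<in>{1..l}. \<not> Psi p (z + c)}"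
      by (auto simp: c_def l_def Psi_def)
  qed
  moreover have "inj_on (\<lambda>y. Psi_hole p y - c) {- int n..int n + 1}"
    using strict_mono_eq[OF strict_mono_Psi_hole] by (auto simp: inj_on_def)
  ultimately have card: "int (card {z\<in>{1..l}. \<not> Psi p (z + c)}) = 2 * int n + 2"
    by (simp add: card_image)
  have "(\<Sum>z\<in>{1..l}. of_bool (Psi p (z + c)) :: int)
      = (\<Sum>z\<in>{1..l}. 1 - of_bool (\<not> Psi p (z + c)))"
    by (intro sum.cong) auto
  also have "\<dots> = l - int (card {z\<in>{1..l}. \<not> Psi p (z + c)})"
    using l by (simp add: sum_subtractf sum.If_cases of_bool_def Int_def conj_commute)
  finally have p: "(\<Sum>z\<in>{1..l}. of_bool (Psi p (z + c)) :: int) = l - (2 * int n + 2)"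
    by (simp only: card)
  have ends: "\<not> Psi p (1 + c)" "\<not> Psi p (l + c)"
    by (auto simp: Psi_def c_def l_def)
  \<comment> \<open>The first exponent is the number \<open>2 * n + 2\<close> of holes minus one. As
    both end sites are empty, the second is \<open>l - (4 * n + 3) = K\<close>. Both are natural
    numbers, so \<open>powi\<close> becomes an ordinary power.\<close>
  have "l - 1 - (l - (2 * int n + 2)) = int (2 * n + 1)"
    "2 * (l - (2 * int n + 2)) - l + 1 - of_bool (Psi p (1 + c)) - of_bool (Psi p (l + c)) = int K"
    using ends l by auto
  then have "pi_marginal \<rho> l (\<lambda>z. Psi p (z + c))
     = (1 - \<rho>) * ((1 - \<rho>) / \<rho>) ^ (2 * n + 1) * ((2 * \<rho> - 1) / \<rho>) ^ K"
    using erg by (simp only: pi_marginal_def p Let_def if_True power_int_of_nat)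
  then show ?thesis
    unfolding a_param_bounds(3)[OF assms] a_param_def[symmetric] c_def l_def K_def .
qed

lemma emeasure_is_pi_cyl:
  assumes \<rho>: "1/2 < \<rho>" "\<rho> < 1" and P: "is_pi \<rho> P" and p: "p \<in> hat_E"
  shows "emeasure (distr (restrict_space P ergodic_inf) hat_space Pi_map) (cyl n p)
     = ennreal ((1 - \<rho>) * (1 - a_param \<rho>) ^ (2 * n + 1)
                  * a_param \<rho> ^ (\<Sum>y\<in>{- int n..int n}. fst p y))"
proof -
  interpret prob_space P using P by (simp add: is_pi_def)
  note sP = sets_is_pi[OF P] and spP = space_is_pi[OF P]
  let ?I = "{\<eta>. \<forall>z\<in>{Psi_hole p (- int n)..Psi_hole p (int n + 1)}. \<eta> z = Psi p z}"
  have "emeasure (distr (restrict_space P ergodic_inf) hat_space Pi_map) (cyl n p)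
      = emeasure (restrict_space P ergodic_inf)
          (Pi_map -` cyl n p \<inter> space (restrict_space P ergodic_inf))"
    by (rule emeasure_distr[OF measurable_Pi_map_is_pi[OF P] cyl_sets[OF p]])
  also have "Pi_map -` cyl n p \<inter> space (restrict_space P ergodic_inf) = ergodic_inf \<inter> ?I"
    unfolding space_restrict_space spP using Pi_map_in_cyl_iff[OF _ p, of _ n] by blast
  also have "emeasure (restrict_space P ergodic_inf) (ergodic_inf \<inter> ?I)
      = emeasure P (ergodic_inf \<inter> ?I)"
    using ergodic_inf_sets by (intro emeasure_restrict_space) (auto simp: spP sP)
  also have "\<dots> = emeasure P ?I"
    using AE_ergodic_inf[OF \<rho> P] ergodic_inf_sets interval_sets
    by (intro emeasure_eq_AE) (auto simp: sP)
  also have "\<dots> = ennreal (measure P ?I)" by (rule emeasure_eq_measure)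
  also have "measure P ?I = (1 - \<rho>) * (1 - a_param \<rho>) ^ (2 * n + 1)
                  * a_param \<rho> ^ (\<Sum>y\<in>{- int n..int n}. fst p y)"
    by (subst is_pi_interval[OF P])
      (simp_all add: strict_mono_less_eq[OF strict_mono_Psi_hole] pi_marginal_Psi[OF \<rho>])
  finally show ?thesis .
qed

section \<open>The image measure on cylinders\<close>

definition omega_marginal :: "real \<Rightarrow> int \<Rightarrow> nat measure" where
  "omega_marginal \<rho> y =
     (if y = 0
      then density (count_space UNIV)
             (\<lambda>k. ennreal ((real k + 2) * a_param \<rho> ^ k * \<rho> * (1 - a_param \<rho>)\<^sup>2))
      else measure_pmf (geometric_pmf (1 - a_param \<rho>)))"

lemma omega_law_eq: "omega_law \<rho> = Pi\<^sub>M UNIV (omega_marginal \<rho>)"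
  by (simp add: omega_law_def omega_marginal_def[abs_def])

lemma sets_omega_marginal [simp]: "sets (omega_marginal \<rho> y) = UNIV"
  by (simp add: omega_marginal_def)

lemma sets_omega_law: "sets (omega_law \<rho>) = sets (Pi\<^sub>M UNIV (\<lambda>_. count_space UNIV))"
  unfolding omega_law_eq by (rule sets_PiM_cong) auto

lemma space_omega_law [simp]: "space (omega_law \<rho>) = UNIV"
  using sets_eq_imp_space_eq[OF sets_omega_law] by (simp add: space_PiM)

text \<open>At index 0 the two geometric series sum to \<rho> (a + 2 (1 - a)) = \<rho> (2 - a),
  which is 1 because a = 2 - 1 / \<rho>.\<close>

lemma prob_space_omega_marginal:
  assumes \<rho>: "1/2 < \<rho>" "\<rho> < 1"
  shows "prob_space (omega_marginal \<rho> y)"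
proof (cases "y = 0")
  case True
  let ?a = "a_param \<rho>"
  note a = a_param_bounds[OF \<rho>]
  have s: "(\<lambda>k. ?a ^ k * real k + 2 * ?a ^ k) sums (?a / (1 - ?a)\<^sup>2 + 2 * (1 / (1 - ?a)))"
    using a by (intro sums_add sums_mult geometric_sums geometric_sums_times_n) auto
  have "(\<lambda>k. \<rho> * (1 - ?a)\<^sup>2 * (?a ^ k * real k + 2 * ?a ^ k))
          sums (\<rho> * (1 - ?a)\<^sup>2 * (?a / (1 - ?a)\<^sup>2 + 2 * (1 / (1 - ?a))))"
    by (rule sums_mult[OF s])
  moreover have "\<rho> * (1 - ?a)\<^sup>2 * (?a / (1 - ?a)\<^sup>2 + 2 * (1 / (1 - ?a))) = \<rho> * (?a + 2 * (1 - ?a))"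
  proof -
    have "b\<^sup>2 * (c / b\<^sup>2 + 2 * (1 / b)) = c + 2 * b" if "b \<noteq> 0" for b c :: real
      using that by (simp add: field_simps power2_eq_square)
    from this[of "1 - ?a" ?a] show ?thesis using a by (simp only: mult.assoc)
  qed
  moreover have "\<rho> * (?a + 2 * (1 - ?a)) = 1"
    using \<rho> by (simp add: a_param_def field_simps)
  ultimately have "(\<lambda>k. (real k + 2) * ?a ^ k * \<rho> * (1 - ?a)\<^sup>2) sums 1"
    by (simp add: algebra_simps)
  then have "(\<Sum>k. ennreal ((real k + 2) * ?a ^ k * \<rho> * (1 - ?a)\<^sup>2)) = ennreal 1"
    using a \<rho> by (intro suminf_ennreal_eq) auto
  then show ?thesis using True
    by (auto intro!: prob_spaceI
        simp: omega_marginal_def emeasure_density nn_integral_count_space_nat)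
next
  case False
  then show ?thesis by (simp add: omega_marginal_def prob_space_measure_pmf)
qed

text \<open>The geometric mass is split off so that the product over a window consists of geometric
  weights and one correction factor at index 0.\<close>

lemma emeasure_omega_marginal:
  assumes \<rho>: "1/2 < \<rho>" "\<rho> < 1"
  shows "emeasure (omega_marginal \<rho> y) {k} = ennreal (a_param \<rho> ^ k * (1 - a_param \<rho>) *
     (if y = 0 then (real k + 2) * \<rho> * (1 - a_param \<rho>) else 1))"
proof -
  have "emeasure (density (count_space UNIV) f) {k} = f k" for f :: "nat \<Rightarrow> ennreal"
    by (subst emeasure_density) (auto simp: nn_integral_indicator_singleton)
  then show ?thesis using a_param_bounds(1,2)[OF \<rho>]
    by (simp add: omega_marginal_def emeasure_pmf_single power2_eq_square mult_ac)
qed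

lemma emeasure_omega_law:
  assumes \<rho>: "1/2 < \<rho>" "\<rho> < 1"
  shows "emeasure (omega_law \<rho>) {\<omega>. \<forall>y\<in>{- int n..int n}. \<omega> y = k y}
     = ennreal ((real (k 0) + 2) * ((1 - \<rho>) * (1 - a_param \<rho>) ^ (2 * n + 1)
                  * a_param \<rho> ^ (\<Sum>y\<in>{- int n..int n}. k y)))"
proof -
  let ?a = "a_param \<rho>" and ?J = "{- int n..int n}"
  note a = a_param_bounds[OF \<rho>]
  interpret product_prob_space "omega_marginal \<rho>" UNIV
  proof -
    interpret prob_space "omega_marginal \<rho> y" for y by (rule prob_space_omega_marginal[OF \<rho>])
    show "product_prob_space (omega_marginal \<rho>)" by unfold_locales
  qed
  have "emeasure (omega_law \<rho>) {\<omega>. \<forall>y\<in>?J. \<omega> y = k y}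
      = emeasure (Pi\<^sub>M UNIV (omega_marginal \<rho>)) {\<omega> \<in> space (Pi\<^sub>M UNIV (omega_marginal \<rho>)). \<forall>y\<in>?J. \<omega> y \<in> {k y}}"
    unfolding omega_law_eq[symmetric] by simp
  also have "\<dots> = (\<Prod>y\<in>?J. emeasure (omega_marginal \<rho> y) {k y})"
    by (rule emeasure_PiM_Collect) auto
  also have "\<dots> = ennreal (\<Prod>y\<in>?J. ?a ^ k y * (1 - ?a) *
      (if y = 0 then (real (k y) + 2) * \<rho> * (1 - ?a) else 1))"
    unfolding emeasure_omega_marginal[OF \<rho>] using a \<rho> by (intro prod_ennreal) auto
  also have "(\<Prod>y\<in>?J. ?a ^ k y * (1 - ?a) * (if y = 0 then (real (k y) + 2) * \<rho> * (1 - ?a) else 1))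
      = ?a ^ (\<Sum>y\<in>?J. k y) * (1 - ?a) ^ (2 * n + 1) * ((real (k 0) + 2) * \<rho> * (1 - ?a))"
  proof -
    have "nat (2 * int n + 1) = 2 * n + 1" by simp
    then show ?thesis by (simp add: prod.distrib power_sum prod.delta)
  qed
  also have "\<dots> = (real (k 0) + 2) * ((\<rho> * (1 - ?a)) * (1 - ?a) ^ (2 * n + 1) * ?a ^ (\<Sum>y\<in>?J. k y))"
    by (simp only: mult_ac)
  also have "\<rho> * (1 - ?a) = 1 - \<rho>" using a \<rho> by simp
  finally show ?thesis .
qed

section \<open>The kernel that places the origin\<close>

definition origin_kernel :: "(int \<Rightarrow> nat) \<Rightarrow> ((int \<Rightarrow> nat) \<times> int) measure" where
  "origin_kernel \<omega> = distr (uniform_count_measure {- int (\<omega> 0) - 1..0}) hat_space (\<lambda>X0. (\<omega>, X0))"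

text \<open>The uniform measure carries the discrete \<sigma>-algebra, so only membership in
  \<open>hat_E\<close> is at stake, and the interval is chosen to ensure it.\<close>

lemma measurable_origin_pair:
  "(\<lambda>X0. (\<omega>, X0)) \<in> uniform_count_measure {- int (\<omega> 0) - 1..0} \<rightarrow>\<^sub>M hat_space"
  by (auto simp: measurable_def space_uniform_count_measure sets_uniform_count_measure hat_E_def)

lemma prob_space_origin_kernel: "prob_space (origin_kernel \<omega>)"
  unfolding origin_kernel_def
  by (rule prob_space.prob_space_distr[OF prob_space_uniform_count_measure measurable_origin_pair]) auto

text \<open>If \<omega> agrees with \<open>fst p\<close> on the window, then \<open>snd p\<close> is
  one of \<open>\<omega> 0 + 2\<close> equally likely sites; otherwise no site qualifies. A constant
  times an indicator is measurable in \<omega> and easy to integrate.\<close>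

lemma emeasure_origin_kernel:
  assumes p: "p \<in> hat_E"
  shows "emeasure (origin_kernel \<omega>) (cyl n p) = ennreal (1 / (real (fst p 0) + 2)) *
     indicator {\<omega>. \<forall>y\<in>{- int n..int n}. \<omega> y = fst p y} \<omega>"
proof -
  let ?U = "uniform_count_measure {- int (\<omega> 0) - 1..0}"
  have e: "emeasure (origin_kernel \<omega>) (cyl n p) = emeasure ?U ((\<lambda>X0. (\<omega>, X0)) -` cyl n p \<inter> space ?U)"
    unfolding origin_kernel_def by (rule emeasure_distr[OF measurable_origin_pair cyl_sets[OF p]])
  show ?thesis
  proof (cases "\<forall>y\<in>{- int n..int n}. \<omega> y = fst p y")
    case True
    then have 0: "\<omega> 0 = fst p 0" by auto
    then have s: "snd p \<in> {- int (\<omega> 0) - 1..0}" using p by (auto simp: hat_E_def)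
    then have "(\<lambda>X0. (\<omega>, X0)) -` cyl n p \<inter> space ?U = {snd p}"
      using True by (auto simp: cyl_def hat_E_def space_uniform_count_measure)
    then show ?thesis using True s 0 unfolding e
      by (simp add: emeasure_uniform_count_measure add.commute)
  next
    case False
    then have "(\<lambda>X0. (\<omega>, X0)) -` cyl n p \<inter> space ?U = {}" by (auto simp: cyl_def)
    then show ?thesis using False unfolding e by auto
  qed
qed

lemma box_sets: "{\<omega>. \<forall>y\<in>{- int n..int n}. \<omega> y = k y} \<in> sets (omega_law \<rho>)"
proof -
  have "{\<omega> \<in> space (Pi\<^sub>M UNIV (\<lambda>_. count_space UNIV)). \<forall>y\<in>{- int n..int n}. \<omega> y = k y}
      \<in> sets (Pi\<^sub>M UNIV (\<lambda>_. count_space (UNIV :: nat set)))"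
    by measurable
  then show ?thesis by (simp add: sets_omega_law space_PiM)
qed

text \<open>For a family of probability measures, measurability can be tested on an
  intersection-stable generator.\<close>

lemma measurable_origin_kernel: "origin_kernel \<in> omega_law \<rho> \<rightarrow>\<^sub>M subprob_algebra hat_space"
proof (rule measurable_prob_algebraD, rule measurable_prob_algebra_generated[OF sets_hat_space Int_stable_cyls cyls_Pow])
  fix \<omega>
  show "prob_space (origin_kernel \<omega>)" by (rule prob_space_origin_kernel)
  show "sets (origin_kernel \<omega>) = sets hat_space" by (simp add: origin_kernel_def)
next
  fix C assume "C \<in> cyls"
  then consider "C = {}" | n p where "C = cyl n p" "p \<in> hat_E" unfolding cyls_def by blast
  then show "(\<lambda>\<omega>. emeasure (origin_kernel \<omega>) C) \<in> borel_measurable (omega_law \<rho>)"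
  proof cases
    case (2 n p)
    show ?thesis unfolding 2(1) emeasure_origin_kernel[OF 2(2)]
      using box_sets by (intro borel_measurable_times_ennreal borel_measurable_indicator) auto
  qed simp
qed

lemma mu_hat_eq: "mu_hat \<rho> = omega_law \<rho> \<bind> origin_kernel"
  by (simp add: mu_hat_def origin_kernel_def[abs_def])

lemma sets_mu_hat: "sets (mu_hat \<rho>) = sets hat_space"
  unfolding mu_hat_eq by (rule sets_bind) (auto simp: origin_kernel_def)

lemma emeasure_mu_hat_cyl:
  assumes \<rho>: "1/2 < \<rho>" "\<rho> < 1" and p: "p \<in> hat_E"
  shows "emeasure (mu_hat \<rho>) (cyl n p)
     = ennreal ((1 - \<rho>) * (1 - a_param \<rho>) ^ (2 * n + 1)
                  * a_param \<rho> ^ (\<Sum>y\<in>{- int n..int n}. fst p y))"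
proof -
  let ?S = "{\<omega>. \<forall>y\<in>{- int n..int n}. \<omega> y = fst p y}"
  have "emeasure (mu_hat \<rho>) (cyl n p) = (\<integral>\<^sup>+\<omega>. emeasure (origin_kernel \<omega>) (cyl n p) \<partial>omega_law \<rho>)"
    unfolding mu_hat_eq
    by (rule emeasure_bind[OF _ measurable_origin_kernel cyl_sets[OF p]]) simp
  also have "\<dots> = ennreal (1 / (real (fst p 0) + 2)) * emeasure (omega_law \<rho>) ?S"
    unfolding emeasure_origin_kernel[OF p] by (rule nn_integral_cmult_indicator[OF box_sets])
  also have "\<dots> = ennreal ((1 - \<rho>) * (1 - a_param \<rho>) ^ (2 * n + 1)
                  * a_param \<rho> ^ (\<Sum>y\<in>{- int n..int n}. fst p y))"
  proof -
    have "1 / (real (fst p 0) + 2) * ((real (fst p 0) + 2) * c) = c" for c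
      by (simp add: field_simps)
    then show ?thesis unfolding emeasure_omega_law[OF \<rho>]
      by (subst ennreal_mult'[symmetric]) auto
  qed
  finally show ?thesis .
qed

section \<open>Comparison of the two measures\<close>

theorem mainTheorem4:
  fixes \<rho> :: real and \<pi>\<^sub>\<rho> :: "config measure"
  assumes "1/2 < \<rho>" and "\<rho> < 1"
    and "is_pi \<rho> \<pi>\<^sub>\<rho>"
  shows "distr (restrict_space \<pi>\<^sub>\<rho> ergodic_inf) hat_space Pi_map = mu_hat \<rho> \<and>
         distr (mu_hat \<rho>) config_space (the_inv_into ergodic_inf Pi_map) = \<pi>\<^sub>\<rho>"
proof
  let ?R = "restrict_space \<pi>\<^sub>\<rho> ergodic_inf"
  show 1: "distr ?R hat_space Pi_map = mu_hat \<rho>"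
  proof -
    have eq: "emeasure (distr ?R hat_space Pi_map) C = emeasure (mu_hat \<rho>) C"
      and fin: "emeasure (distr ?R hat_space Pi_map) C \<noteq> \<infinity>" if "C \<in> cyls" for C
    proof -
      from that consider "C = {}" | n p where "C = cyl n p" "p \<in> hat_E" unfolding cyls_def by blast
      then have "emeasure (distr ?R hat_space Pi_map) C = emeasure (mu_hat \<rho>) C \<and>
          emeasure (distr ?R hat_space Pi_map) C \<noteq> \<infinity>"
        by cases (simp_all add: emeasure_is_pi_cyl[OF assms] emeasure_mu_hat_cyl[OF assms(1,2)])
      then show "emeasure (distr ?R hat_space Pi_map) C = emeasure (mu_hat \<rho>) C"
        "emeasure (distr ?R hat_space Pi_map) C \<noteq> \<infinity>" by auto
    qed
    \<comment> \<open>Agreement on an intersection-stable generator suffices; the countable cover by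
      cylinders of finite mass supplies \<sigma>-finiteness.\<close>
    show ?thesis
      by (rule measure_eqI_generator_eq_countable[OF Int_stable_cyls cyls_Pow eq _ _
            subset_refl Union_cyls countable_cyls fin])
        (simp_all add: sets_mu_hat sets_hat_space)
  qed
  note sP = sets_is_pi[OF assms(3)] and spP = space_is_pi[OF assms(3)]
  \<comment> \<open>The inverse is unspecified outside \<open>hat_E\<close>, but
    \<open>mu_hat \<rho>\<close> lives on \<open>hat_E\<close>, where it equals
    \<open>Psi\<close>.\<close>
  have "distr (mu_hat \<rho>) config_space (the_inv_into ergodic_inf Pi_map)
      = distr (mu_hat \<rho>) config_space Psi"
    using sets_eq_imp_space_eq[OF sets_mu_hat]
    by (intro distr_cong) (auto simp: the_inv_into_Pi_map)
  \<comment> \<open>The first identity presents \<open>mu_hat \<rho>\<close> as an image under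
    \<open>Pi_map\<close>; composing with \<open>Psi\<close> gives the identity on
    \<open>ergodic_inf\<close>.\<close>
  also have "\<dots> = distr ?R config_space (Psi \<circ> Pi_map)"
    unfolding 1[symmetric] by (rule distr_distr[OF measurable_Psi measurable_Pi_map_is_pi[OF assms(3)]])
  also have "\<dots> = distr ?R config_space (\<lambda>\<eta>. \<eta>)"
    by (intro distr_cong) (auto simp: space_restrict_space Psi_Pi_map)
  \<comment> \<open>Restricting to a set of full measure and embedding back into the configuration
    space recovers the measure.\<close>
  also have "\<dots> = \<pi>\<^sub>\<rho>"
  proof (rule measure_eqI)
    fix A assume "A \<in> sets (distr ?R config_space (\<lambda>\<eta>. \<eta>))"
    then have A: "A \<in> sets config_space" by simp
    have "(\<lambda>\<eta>. \<eta>) \<in> ?R \<rightarrow>\<^sub>M config_space"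
      by (intro measurable_restrict_space1) (simp add: measurable_cong_sets[OF sP refl])
    then have "emeasure (distr ?R config_space (\<lambda>\<eta>. \<eta>)) A = emeasure ?R (A \<inter> ergodic_inf)"
      using A by (simp add: emeasure_distr space_restrict_space spP)
    also have "\<dots> = emeasure \<pi>\<^sub>\<rho> (A \<inter> ergodic_inf)"
      using ergodic_inf_sets by (intro emeasure_restrict_space) (auto simp: spP sP)
    also have "\<dots> = emeasure \<pi>\<^sub>\<rho> A"
      using AE_ergodic_inf[OF assms] ergodic_inf_sets A
      by (intro emeasure_eq_AE) (auto simp: sP)
    finally show "emeasure (distr ?R config_space (\<lambda>\<eta>. \<eta>)) A = emeasure \<pi>\<^sub>\<rho> A" .
  qed (simp add: sP)
  finally show "distr (mu_hat \<rho>) config_space (the_inv_into ergodic_inf Pi_map) = \<pi>\<^sub>\<rho>" .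
qed

end
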